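(* Let $a\in\mathbb{C}\setminus\{0,-1,-2,\ldots\}$, and let $z,s\in\mathbb{C}$ be such that the series defining the functions $H_k(z,s,a)$ converge absolutely (that is, $|z|<1$, or $|z|=1$ and $\operatorname{Re}(s)>3$). For $N\in\mathbb{N}_0$, $$\sum_{k=0}^{N}H_k(z,s,a)=\frac12\left(4^{N+1}-1\right)D^2\Phi(z,s,a)+\frac32\left(2^{N+1}-1\right)D\Phi(z,s,a)+(N+1)\Phi(z,s,a).$$
   Context: $\mathbb{N}_0=\{0,1,2,\ldots\}$. The $k$-augmented centered triangular numbers are given by $A(r+1,k)=\frac32 4^k r^2+\frac32 2^k r+1$ for integers $r,k\ge0$. Complex powers are principal: $(r+a)^{-s}=\exp\{-s\operatorname{Log}(r+a)\}$, $-\pi<\operatorname{Arg}\le\pi$. The Hurwitz--Lerch transcendent is $\Phi(z,s,a)=\sum_{r=0}^{\infty}\frac{z^r}{(r+a)^s}$, and $H_k(z,s,a)=\sum_{r=0}^{\infty}\frac{A(r+1,k)z^r}{(r+a)^s}$. $D=z\frac{d}{dz}$ is the Euler operator; for $|z|<1$, $D^j\Phi(z,s,a)$ is the result of applying $D$ $j$ times to $\Phi$ in the variable $z$, and at points $|z|=1$ the symbol $D^j\Phi(z,s,a)$ means the termwise-differentiated series $\sum_{r\ge0} r^j z^r/(r+a)^s$ (absolutely convergent there). *)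

theory Defs
  imports "HOL-Analysis.Analysis"
begin

text \<open>
  The mathematical formula is given in terms of \<open>A(r + 1, k)\<close>, hence \<open>n - 1\<close> below (subtraction
  of reals, not of natural numbers). Only indices \<open>n \<ge> 1\<close> are meaningful.
\<close>
definition aug_triangular :: "nat \<Rightarrow> nat \<Rightarrow> real" where
  "aug_triangular n k = 3/2 * 4 ^ k * (real n - 1)\<^sup>2 + 3/2 * 2 ^ k * (real n - 1) + 1"

text \<open>
  Complex \<open>powr\<close> uses the principal logarithm, with imaginary part in the interval from \<open>-pi\<close>
  (exclusive) to \<open>pi\<close> (inclusive). The junk value \<open>0 powr s = 0\<close> is never used if \<open>a\<close> is not a
  nonpositive integer.
\<close>
definition hurwitz_lerch :: "complex \<Rightarrow> complex \<Rightarrow> complex \<Rightarrow> complex" where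
  "hurwitz_lerch z s a = (\<Sum>r. z ^ r / (of_nat r + a) powr s)"

definition H_term :: "nat \<Rightarrow> complex \<Rightarrow> complex \<Rightarrow> complex \<Rightarrow> nat \<Rightarrow> complex" where
  "H_term k z s a r = of_real (aug_triangular (r + 1) k) * z ^ r / (of_nat r + a) powr s"

definition H :: "nat \<Rightarrow> complex \<Rightarrow> complex \<Rightarrow> complex \<Rightarrow> complex" where
  "H k z s a = (\<Sum>r. H_term k z s a r)"

definition euler_op :: "(complex \<Rightarrow> complex) \<Rightarrow> complex \<Rightarrow> complex" where
  "euler_op f = (\<lambda>z. z * deriv f z)"

text \<open>
  Inside the open unit disc, the Euler operator is genuinely iterated on \<open>\<Phi>\<close> in its first
  argument. On the unit circle, \<open>D\<^sup>j \<Phi>\<close> denotes by convention the termwise differentiated series.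
  The values for \<open>|z| > 1\<close> are irrelevant.
\<close>
definition euler_hurwitz_lerch :: "nat \<Rightarrow> complex \<Rightarrow> complex \<Rightarrow> complex \<Rightarrow> complex" where
  "euler_hurwitz_lerch j z s a =
     (if norm z < 1 then (euler_op ^^ j) (\<lambda>w. hurwitz_lerch w s a) z
      else (\<Sum>r. of_nat r ^ j * z ^ r / (of_nat r + a) powr s))"

end

theory Submission
  imports Defs "HOL-Real_Asymp.Real_Asymp"
begin

text \<open>
  Shifting the index, \<open>A(r + 1, k) = 3/2 4\<^sup>k r\<^sup>2 + 3/2 2\<^sup>k r + 1\<close> is a polynomial in \<open>r\<close>, so
  \<open>H\<^sub>k\<close> is the same combination of the three series
  \<open>\<Sum>r. r\<^sup>j z\<^sup>r / (r + a)\<^sup>s\<close> with \<open>j = 2, 1, 0\<close>. Each of these is \<open>D\<^sup>j \<Phi>\<close>: on the unit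
  circle by convention, and inside the disc because a power series may be differentiated termwise
  (\<open>euler_op_funpow_power_series\<close>). Summing over \<open>k\<close> only involves the geometric sums of
  \<open>4\<^sup>k\<close> and \<open>2\<^sup>k\<close>.

  The domain of absolute convergence comes from \<open>|(r + a)\<^sup>s| \<sim> r\<^bsup>Re s\<^esup>\<close>
  (\<open>norm_shifted_powr_asymp_equiv\<close>): the \<open>j\<close>-th series behaves like
  \<open>\<Sum>r. r\<^bsup>j - Re s\<^esup> |z|\<^sup>r\<close>, which converges exactly if \<open>|z| < 1\<close>, or \<open>|z| = 1\<close> and
  \<open>Re s > j + 1\<close> (\<open>summable_norm_lerch_term_iff\<close>). Since \<open>A(r + 1, 0) \<ge> r\<^sup>2\<close>, the series
  \<open>H\<^sub>0\<close> dominates the one for \<open>j = 2\<close>, which is therefore the decisive one.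
\<close>

section \<open>Absolute convergence\<close>

definition lerch_term :: "nat \<Rightarrow> complex \<Rightarrow> complex \<Rightarrow> complex \<Rightarrow> nat \<Rightarrow> complex" where
  "lerch_term j z s a r = of_nat r ^ j * z ^ r / (of_nat r + a) powr s"

text \<open>
  For \<open>r > 0\<close> the positive real factor \<open>r\<close> splits off the principal power without a change of
  branch, \<open>(r + a)\<^sup>s = r\<^sup>s (1 + a/r)\<^sup>s\<close>, and \<open>(1 + a/r)\<^sup>s\<close> tends to \<open>1\<close>.
\<close>
lemma norm_shifted_powr_asymp_equiv:
  fixes a s :: complex
  shows "(\<lambda>r. norm ((of_nat r + a) powr s)) \<sim>[at_top] (\<lambda>r. real r powr Re s)"
proof (rule asymp_equivI')
  have lim: "(\<lambda>r. norm ((1 + a / of_nat r) powr s)) \<longlonglongrightarrow> norm ((1 + 0) powr s)"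
    by (intro tendsto_norm tendsto_powr_complex tendsto_add tendsto_const lim_const_over_n) auto
  have "\<forall>\<^sub>F r in at_top. norm ((1 + a / of_nat r) powr s) =
          norm ((of_nat r + a) powr s) / real r powr Re s"
    using eventually_gt_at_top[of 0]
  proof eventually_elim
    case (elim r)
    have eq: "of_nat r + a = of_real (real r) * (1 + a / of_nat r)"
      using elim by (simp add: field_simps)
    have "(of_nat r + a) powr s = of_real (real r) powr s * (1 + a / of_nat r) powr s"
      unfolding eq by (rule powr_times_real_left) auto
    moreover have "norm (of_real (real r) powr s) = real r powr Re s"
      using elim by (subst norm_powr_real_powr) auto
    ultimately show ?case
      using elim by (simp add: norm_mult)
  qed
  from Lim_transform_eventually[OF lim this]
  show "(\<lambda>r. norm ((of_nat r + a) powr s) / real r powr Re s) \<longlonglongrightarrow> 1"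
    by simp
qed

lemma norm_lerch_term_bigtheta:
  "(\<lambda>r. norm (lerch_term j z s a r)) \<in> \<Theta>(\<lambda>r. real r powr (real j - Re s) * norm z ^ r)"
proof -
  have "(\<lambda>r. real r ^ j * norm z ^ r / norm ((of_nat r + a) powr s))
          \<in> \<Theta>(\<lambda>r. real r ^ j * norm z ^ r / real r powr Re s)"
    by (intro asymp_equiv_imp_bigtheta asymp_equiv_divide asymp_equiv_refl
          norm_shifted_powr_asymp_equiv)
  also have "(\<lambda>r. real r ^ j * norm z ^ r / real r powr Re s)
               \<in> \<Theta>(\<lambda>r. real r powr (real j - Re s) * norm z ^ r)"
    by (intro bigthetaI_cong eventually_mono[OF eventually_gt_at_top[of 0]])
       (auto simp: powr_diff powr_realpow)
  finally show ?thesis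
    by (simp add: lerch_term_def norm_mult norm_divide norm_power)
qed

lemma summable_powr_times_geometric_iff:
  fixes p x :: real
  assumes "x \<ge> 0"
  shows "summable (\<lambda>r. real r powr p * x ^ r) \<longleftrightarrow> x < 1 \<or> x = 1 \<and> p < -1"
proof -
  consider "x = 0" | "0 < x" "x < 1" | "x = 1" | "x > 1"
    using assms by linarith
  thus ?thesis
  proof cases
    case 1
    have "summable (\<lambda>r. real r powr p * x ^ r)"
      using 1 by (intro summable_finite[of "{0}"]) auto
    thus ?thesis using 1 by simp
  next
    case 2
    \<comment> \<open>Any geometric ratio strictly between \<open>x\<close> and \<open>1\<close> absorbs the power of \<open>r\<close>.\<close>
    define y where "y = (x + 1) / 2"
    have y: "x < y" "y < 1" "0 < y"
      using 2 by (auto simp: y_def)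
    have "(\<lambda>r. real r powr p * x ^ r) \<in> O(\<lambda>r. y ^ r)"
      using 2 y by real_asymp
    moreover have "summable (\<lambda>r. norm (y ^ r))"
      using y by (simp add: norm_power summable_geometric)
    ultimately have "summable (\<lambda>r. real r powr p * x ^ r)"
      by (rule summable_comparison_test_bigo[rotated])
    thus ?thesis using 2 by simp
  next
    case 3
    thus ?thesis by (simp add: summable_real_powr_iff)
  next
    case 4
    have "filterlim (\<lambda>r. real r powr p * x ^ r) at_top at_top"
      using 4 by real_asymp
    hence "\<not> summable (\<lambda>r. real r powr p * x ^ r)"
      using not_tendsto_and_filterlim_at_infinity[OF sequentially_bot summable_LIMSEQ_zero
          filterlim_at_top_imp_at_infinity]
      by auto
    thus ?thesis using 4 by simp
  qed
qed

lemma summable_norm_lerch_term_iff: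
  "summable (\<lambda>r. norm (lerch_term j z s a r)) \<longleftrightarrow>
     norm z < 1 \<or> (norm z = 1 \<and> Re s > real j + 1)"
proof -
  let ?g = "\<lambda>r. real r powr (real j - Re s) * norm z ^ r"
  have "summable (\<lambda>r. norm (lerch_term j z s a r)) \<longleftrightarrow> summable ?g"
  proof
    assume "summable (\<lambda>r. norm (lerch_term j z s a r))"
    moreover have "?g \<in> O(\<lambda>r. norm (lerch_term j z s a r))"
      by (intro bigthetaD1) (subst bigtheta_sym, rule norm_lerch_term_bigtheta)
    ultimately show "summable ?g"
      by - (rule summable_comparison_test_bigo, simp_all)
  next
    assume "summable ?g"
    moreover have "(\<lambda>r. norm (lerch_term j z s a r)) \<in> O(?g)"
      by (rule bigthetaD1[OF norm_lerch_term_bigtheta])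
    ultimately show "summable (\<lambda>r. norm (lerch_term j z s a r))"
      by - (rule summable_comparison_test_bigo, simp_all add: abs_mult)
  qed
  also have "\<dots> \<longleftrightarrow> norm z < 1 \<or> (norm z = 1 \<and> Re s > real j + 1)"
    by (subst summable_powr_times_geometric_iff) auto
  finally show ?thesis .
qed

section \<open>The Euler operator on power series\<close>

lemma euler_op_power_series:
  fixes c :: "nat \<Rightarrow> complex"
  assumes summable: "\<And>w. norm w < R \<Longrightarrow> summable (\<lambda>r. c r * w ^ r)"
    and z: "norm z < R"
  shows "euler_op (\<lambda>w. \<Sum>r. c r * w ^ r) z = (\<Sum>r. of_nat r * c r * z ^ r)"
    and "summable (\<lambda>r. of_nat r * c r * z ^ r)"
proof -
  have "((\<lambda>w. \<Sum>r. c r * w ^ r) has_field_derivative (\<Sum>r. diffs c r * z ^ r)) (at z)"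
    using assms by (rule termdiffs_strong')
  hence deriv: "deriv (\<lambda>w. \<Sum>r. c r * w ^ r) z = (\<Sum>r. diffs c r * z ^ r)"
    by (rule DERIV_imp_deriv)
  have "summable (\<lambda>r. diffs c r * z ^ r)"
    using z summable by (rule termdiff_converges)
  hence "(\<lambda>r. of_nat r * c r * z ^ (r - Suc 0)) sums (\<Sum>r. diffs c r * z ^ r)"
    by (rule diffs_equiv)
  hence "(\<lambda>r. z * (of_nat r * c r * z ^ (r - Suc 0))) sums (z * (\<Sum>r. diffs c r * z ^ r))"
    by (rule sums_mult)
  also have "(\<lambda>r. z * (of_nat r * c r * z ^ (r - Suc 0))) = (\<lambda>r. of_nat r * c r * z ^ r)"
  proof
    fix r show "z * (of_nat r * c r * z ^ (r - Suc 0)) = of_nat r * c r * z ^ r"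
      by (cases r) auto
  qed
  finally have sums: "(\<lambda>r. of_nat r * c r * z ^ r) sums (z * (\<Sum>r. diffs c r * z ^ r))" .
  show "euler_op (\<lambda>w. \<Sum>r. c r * w ^ r) z = (\<Sum>r. of_nat r * c r * z ^ r)"
    using sums by (simp add: euler_op_def deriv sums_iff)
  show "summable (\<lambda>r. of_nat r * c r * z ^ r)"
    using sums by (rule sums_summable)
qed

lemma euler_op_cong_open:
  assumes "open S" "z \<in> S" "\<And>w. w \<in> S \<Longrightarrow> f w = g w"
  shows "euler_op f z = euler_op g z"
proof -
  have "\<forall>\<^sub>F w in nhds z. f w = g w"
    using assms by (auto simp: eventually_nhds)
  thus ?thesis by (simp add: euler_op_def deriv_cong_ev)
qed

text \<open>
  A further differentiation at \<open>z\<close> needs the current identity, and convergence of the current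
  series, at all points near \<open>z\<close>, so the induction carries both on the whole disc.
\<close>
lemma euler_op_funpow_power_series:
  fixes c :: "nat \<Rightarrow> complex"
  assumes summable: "\<And>w. norm w < R \<Longrightarrow> summable (\<lambda>r. c r * w ^ r)"
    and z: "norm z < R"
  shows "(euler_op ^^ j) (\<lambda>w. \<Sum>r. c r * w ^ r) z = (\<Sum>r. of_nat r ^ j * c r * z ^ r)"
proof -
  have "(euler_op ^^ j) (\<lambda>w. \<Sum>r. c r * w ^ r) z = (\<Sum>r. of_nat r ^ j * c r * z ^ r) \<and>
        summable (\<lambda>r. of_nat r ^ j * c r * z ^ r)"
    using z
  proof (induction j arbitrary: z)
    case 0
    thus ?case using summable by simp
  next
    case (Suc j)
    have "(euler_op ^^ Suc j) (\<lambda>w. \<Sum>r. c r * w ^ r) z =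
          euler_op (\<lambda>w. \<Sum>r. of_nat r ^ j * c r * w ^ r) z"
      unfolding funpow.simps comp_apply using Suc
      by (intro euler_op_cong_open[of "ball 0 R"]) auto
    with euler_op_power_series[of R "\<lambda>r. of_nat r ^ j * c r" z] Suc
    show ?case by (simp add: mult.assoc)
  qed
  thus ?thesis ..
qed

section \<open>The sum formula\<close>

lemma hurwitz_lerch_eq_suminf: "hurwitz_lerch z s a = (\<Sum>r. lerch_term 0 z s a r)"
  by (simp add: hurwitz_lerch_def lerch_term_def)

lemma euler_hurwitz_lerch_eq_suminf:
  "euler_hurwitz_lerch j z s a = (\<Sum>r. lerch_term j z s a r)"
proof (cases "norm z < 1")
  case True
  let ?c = "\<lambda>r. 1 / (of_nat r + a) powr s"
  have "summable (\<lambda>r. ?c r * w ^ r)" if "norm w < 1" for w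
  proof -
    have "summable (lerch_term 0 w s a)"
      using that by - (rule summable_norm_cancel, simp add: summable_norm_lerch_term_iff)
    thus ?thesis by (simp add: lerch_term_def[abs_def])
  qed
  from euler_op_funpow_power_series[OF this True, of j] True
  show ?thesis
    by (simp add: euler_hurwitz_lerch_def hurwitz_lerch_def lerch_term_def)
qed (simp add: euler_hurwitz_lerch_def lerch_term_def)

lemma H_term_eq_lerch_terms:
  "H_term k z s a r =
     3/2 * 4 ^ k * lerch_term 2 z s a r + 3/2 * 2 ^ k * lerch_term 1 z s a r + lerch_term 0 z s a r"
  by (simp add: H_term_def aug_triangular_def lerch_term_def ring_distribs add_divide_distrib mult.assoc)

text \<open>
  Absolute convergence of \<open>H\<^sub>0\<close> alone thus forces that of the series with weight \<open>r\<^sup>2\<close>,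
  which gives the necessity of \<open>Re s > 3\<close> on the unit circle.
\<close>
lemma norm_lerch_term_le_H_term: "norm (lerch_term 2 z s a r) \<le> norm (H_term 0 z s a r)"
proof -
  have "aug_triangular (r + 1) 0 = 3/2 * real r ^ 2 + 3/2 * real r + 1"
    by (simp add: aug_triangular_def)
  hence "real r ^ 2 \<le> \<bar>aug_triangular (r + 1) 0\<bar>"
    using zero_le_power2[of "real r"] by linarith
  hence "real r ^ 2 * (norm (z ^ r) / norm ((of_nat r + a) powr s)) \<le>
         \<bar>aug_triangular (r + 1) 0\<bar> * (norm (z ^ r) / norm ((of_nat r + a) powr s))"
    by (intro mult_right_mono) auto
  thus ?thesis
    by (simp add: lerch_term_def H_term_def norm_mult norm_divide norm_power)
qed

lemma summable_norm_H_term_iff: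
  "(\<forall>k. summable (\<lambda>r. norm (H_term k z s a r))) \<longleftrightarrow> norm z < 1 \<or> (norm z = 1 \<and> Re s > 3)"
proof
  assume "\<forall>k. summable (\<lambda>r. norm (H_term k z s a r))"
  hence "summable (\<lambda>r. norm (H_term 0 z s a r))" ..
  hence "summable (\<lambda>r. norm (lerch_term 2 z s a r))"
    by (rule summable_comparison_test'[where N = 0]) (simp add: norm_lerch_term_le_H_term)
  thus "norm z < 1 \<or> (norm z = 1 \<and> Re s > 3)"
    by (simp add: summable_norm_lerch_term_iff)
next
  assume *: "norm z < 1 \<or> (norm z = 1 \<and> Re s > 3)"
  show "\<forall>k. summable (\<lambda>r. norm (H_term k z s a r))"
  proof
    fix k
    let ?t = "\<lambda>j r. norm (lerch_term j z s a r)"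
    have "summable (?t j)" if "j \<le> 2" for j
      using * that by (auto simp: summable_norm_lerch_term_iff)
    hence "summable (\<lambda>r. 3/2 * 4 ^ k * ?t 2 r + 3/2 * 2 ^ k * ?t 1 r + ?t 0 r)"
      by (intro summable_add summable_mult) auto
    thus "summable (\<lambda>r. norm (H_term k z s a r))"
    proof (rule summable_comparison_test'[where N = 0])
      fix r
      have "norm (H_term k z s a r) \<le> norm (3/2 * 4 ^ k * lerch_term 2 z s a r) +
              norm (3/2 * 2 ^ k * lerch_term 1 z s a r) + ?t 0 r"
        unfolding H_term_eq_lerch_terms by (intro norm_triangle_mono order.refl)
      thus "norm (norm (H_term k z s a r)) \<le> 3/2 * 4 ^ k * ?t 2 r + 3/2 * 2 ^ k * ?t 1 r + ?t 0 r"
        by (simp add: norm_mult norm_power norm_divide)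
    qed
  qed
qed

lemma H_eq_euler_hurwitz_lerch:
  assumes "norm z < 1 \<or> (norm z = 1 \<and> Re s > 3)"
  shows "H k z s a = 3/2 * 4 ^ k * euler_hurwitz_lerch 2 z s a +
           3/2 * 2 ^ k * euler_hurwitz_lerch 1 z s a + hurwitz_lerch z s a"
proof -
  have "summable (lerch_term j z s a)" if "j \<le> 2" for j
    using assms that by - (rule summable_norm_cancel, auto simp: summable_norm_lerch_term_iff)
  hence "(\<lambda>r. 3/2 * 4 ^ k * lerch_term 2 z s a r + 3/2 * 2 ^ k * lerch_term 1 z s a r +
            lerch_term 0 z s a r) sums
         (3/2 * 4 ^ k * (\<Sum>r. lerch_term 2 z s a r) + 3/2 * 2 ^ k * (\<Sum>r. lerch_term 1 z s a r) +
            (\<Sum>r. lerch_term 0 z s a r))"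
    by (intro sums_add sums_mult summable_sums) auto
  thus ?thesis
    by (simp add: H_def H_term_eq_lerch_terms euler_hurwitz_lerch_eq_suminf
          hurwitz_lerch_eq_suminf sums_iff)
qed

theorem corollary6p4:
  fixes a z s :: complex and N :: nat
  assumes "a \<notin> \<int>\<^sub>\<le>\<^sub>0"
  shows "((\<forall>k. summable (\<lambda>r. norm (H_term k z s a r))) \<longleftrightarrow>
            norm z < 1 \<or> (norm z = 1 \<and> Re s > 3)) \<and>
         ((\<forall>k. summable (\<lambda>r. norm (H_term k z s a r))) \<longrightarrow>
            (\<Sum>k=0..N. H k z s a) =
              1/2 * (4 ^ (N + 1) - 1) * euler_hurwitz_lerch 2 z s a
              + 3/2 * (2 ^ (N + 1) - 1) * euler_hurwitz_lerch 1 z s a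
              + (of_nat N + 1) * hurwitz_lerch z s a)"
proof (intro conjI impI)
  show "(\<forall>k. summable (\<lambda>r. norm (H_term k z s a r))) \<longleftrightarrow>
          norm z < 1 \<or> (norm z = 1 \<and> Re s > 3)"
    by (rule summable_norm_H_term_iff)
next
  assume "\<forall>k. summable (\<lambda>r. norm (H_term k z s a r))"
  hence *: "norm z < 1 \<or> (norm z = 1 \<and> Re s > 3)"
    by (simp only: summable_norm_H_term_iff)
  show "(\<Sum>k=0..N. H k z s a) =
              1/2 * (4 ^ (N + 1) - 1) * euler_hurwitz_lerch 2 z s a
              + 3/2 * (2 ^ (N + 1) - 1) * euler_hurwitz_lerch 1 z s a
              + (of_nat N + 1) * hurwitz_lerch z s a"
    by (induction N) (simp_all add: H_eq_euler_hurwitz_lerch[OF *] algebra_simps)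
qed

end
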